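(* Let $X$ be a nice space, let $e$ be an end of $X$, and let $k\ge0$. The geometric proper homology group $\underline H_k^{\mathsf{geo}}(X,e)$ is isomorphic to the algebraic proper homology group $\underline H_k^{\mathsf{alg}}(X,e)$.
   Context: A topological space is nice if it is non-compact, connected, locally path connected, locally compact, Hausdorff and second countable. An efficient exhaustion of $X$ is a sequence $K_0\subseteq K_1\subseteq\cdots$ of compact connected subsets with $\bigcup_iK_i=X$, $K_i\subseteq\operatorname{int}(K_{i+1})$, and every connected component of $X\setminus K_i$ having non-compact closure (every nice space admits one; fix one). An end of $X$ is a sequence $e=(U^{(0)}\supseteq U^{(1)}\supseteq\cdots)$ with $U^{(i)}$ a connected component of $X\setminus K_i$. A sequence $\{Z_n\}$ of subsets of $X$ converges to $e$ if for every $i$ there is $n_i$ with $Z_n\subseteq U^{(i)}$ for all $n\ge n_i$. Asymptotic limit. For an inverse system of groups $\underline G=\{G_n,p^m_n\}_{m\ge n\ge0}$, let $\mathscr S_{\underline G}$ be the set of sequences $\{g_{k(n)}\}_{n\ge0}$ with $g_{k(n)}\in G_{k(n)}$ and $k(n)\to\infty$. Put $\{g_{k(n)}\}\sim\{g'_{l(n)}\}$ if there are integers $m(n)\ge 0$ with $m(n)\to\infty$, $m(n)\le\min\{k(n),l(n)\}$, and $p^{k(n)}_{m(n)}(g_{k(n)})=p^{l(n)}_{m(n)}(g'_{l(n)})$ for all sufficiently large $n$. Then $\wp(\underline G)=\mathscr S_{\underline G}/{\sim}$, a group under $[\{g_{k(n)}\}]\cdot[\{h_{l(n)}\}]=[\{p^{k(n)}_{m(n)}(g_{k(n)})\,p^{l(n)}_{m(n)}(h_{l(n)})\}]$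 with $m(n)=\min\{k(n),l(n)\}$. Algebraic proper homology: $\underline H_k^{\mathsf{alg}}(X,e)=\wp(\{H_k(U^{(n)})\})$, where $H_k$ is integral singular homology and the bonding maps $H_k(U^{(m)})\to H_k(U^{(n)})$, $m\ge n$, are induced by inclusion. Geometric proper homology: $C_k(X)$ is the group of integral singular $k$-chains with boundary $\partial_k$; $\operatorname{supp}(c)$ is the union of the images of the singular simplices occurring with non-zero coefficient in the reduced form of $c$ ($\operatorname{supp}(0)=\varnothing$). $\underline C_k(X,e)$ is the group of sequences $\{c_n\}_{n\ge0}\in\prod_{n\ge0}C_k(X)$ with $\{\operatorname{supp}(c_n)\}$ converging to $e$; $\underline Z_k(X,e)$ is the subgroup of those with $\partial_kc_n=0$ for all sufficiently large $n$; $\underline B_k(X,e)$ is the subgroup of those for which there is $\{b_n\}\in\underline C_{k+1}(X,e)$ with $c_n=\partial_{k+1}b_n$ for all sufficiently large $n$. Then $\underline H_k^{\mathsf{geo}}(X,e)=\underline Z_k(X,e)/\underline B_k(X,e)$. *)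

theory Defs
  imports "HOL-Analysis.Analysis" "HOL-Homology.Homology"
begin

section \<open>Nice spaces, efficient exhaustions and ends\<close>

definition nice_space :: "'a topology \<Rightarrow> bool" where
  "nice_space X \<longleftrightarrow>
     \<not> compact_space X \<and> connected_space X \<and> locally_path_connected_space X \<and>
     locally_compact_space X \<and> Hausdorff_space X \<and> second_countable X"

definition efficient_exhaustion :: "'a topology \<Rightarrow> (nat \<Rightarrow> 'a set) \<Rightarrow> bool" where
  "efficient_exhaustion X K \<longleftrightarrow>
     (\<forall>i. compactin X (K i) \<and> connectedin X (K i) \<and> K i \<subseteq> K (Suc i)) \<and>
     (\<Union>i. K i) = topspace X \<and>
     (\<forall>i. K i \<subseteq> X interior_of K (Suc i)) \<and>
     (\<forall>i. \<forall>C \<in> connected_components_of (subtopology X (topspace X - K i)).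
        \<not> compactin X (X closure_of C))"

definition space_end :: "'a topology \<Rightarrow> (nat \<Rightarrow> 'a set) \<Rightarrow> (nat \<Rightarrow> 'a set) \<Rightarrow> bool" where
  "space_end X K e \<longleftrightarrow>
     (\<forall>i. e i \<in> connected_components_of (subtopology X (topspace X - K i)) \<and> e (Suc i) \<subseteq> e i)"

definition converges_to_end :: "(nat \<Rightarrow> 'a set) \<Rightarrow> (nat \<Rightarrow> 'a set) \<Rightarrow> bool" where
  "converges_to_end Z e \<longleftrightarrow> (\<forall>i. \<exists>n\<^sub>i. \<forall>n\<ge>n\<^sub>i. Z n \<subseteq> e i)"


section \<open>The asymptotic limit of an inverse system of groups\<close>

text \<open>The bonding map from \<open>G m\<close> to \<open>G n\<close>, for \<open>m \<ge> n\<close>, is \<open>p m n\<close>.\<close>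

definition inverse_system :: "(nat \<Rightarrow> 'g monoid) \<Rightarrow> (nat \<Rightarrow> nat \<Rightarrow> 'g \<Rightarrow> 'g) \<Rightarrow> bool" where
  "inverse_system G p \<longleftrightarrow>
     (\<forall>n. group (G n)) \<and>
     (\<forall>m n. n \<le> m \<longrightarrow> p m n \<in> hom (G m) (G n)) \<and>
     (\<forall>n. \<forall>x \<in> carrier (G n). p n n x = x) \<and>
     (\<forall>l m n. n \<le> m \<longrightarrow> m \<le> l \<longrightarrow> (\<forall>x \<in> carrier (G l). p m n (p l m x) = p l n x))"

text \<open>A pair \<open>(k, g)\<close> encodes the sequence whose \<open>n\<close>-th term is the element \<open>g n\<close>
  of the group with index \<open>k n\<close>.\<close>

definition asym_seqs :: "(nat \<Rightarrow> 'g monoid) \<Rightarrow> ((nat \<Rightarrow> nat) \<times> (nat \<Rightarrow> 'g)) set" where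
  "asym_seqs G = {(k, g). filterlim k at_top sequentially \<and> (\<forall>n. g n \<in> carrier (G (k n)))}"

definition asym_rel ::
  "(nat \<Rightarrow> 'g monoid) \<Rightarrow> (nat \<Rightarrow> nat \<Rightarrow> 'g \<Rightarrow> 'g) \<Rightarrow> ((nat \<Rightarrow> nat) \<times> (nat \<Rightarrow> 'g)) rel" where
  "asym_rel G p =
     {((k, g), (l, h)). (k, g) \<in> asym_seqs G \<and> (l, h) \<in> asym_seqs G \<and>
        (\<exists>m. filterlim m at_top sequentially \<and> (\<forall>n. m n \<le> min (k n) (l n)) \<and>
             (\<forall>\<^sub>F n in sequentially. p (k n) (m n) (g n) = p (l n) (m n) (h n)))}"

fun asym_mult ::
  "(nat \<Rightarrow> 'g monoid) \<Rightarrow> (nat \<Rightarrow> nat \<Rightarrow> 'g \<Rightarrow> 'g) \<Rightarrow>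
     (nat \<Rightarrow> nat) \<times> (nat \<Rightarrow> 'g) \<Rightarrow> (nat \<Rightarrow> nat) \<times> (nat \<Rightarrow> 'g) \<Rightarrow> (nat \<Rightarrow> nat) \<times> (nat \<Rightarrow> 'g)" where
  "asym_mult G p (k, g) (l, h) =
     (let m = (\<lambda>n. min (k n) (l n))
      in (m, \<lambda>n. p (k n) (m n) (g n) \<otimes>\<^bsub>G (m n)\<^esub> p (l n) (m n) (h n)))"

text \<open>The product of two classes is the union of the classes of all products of
  representatives; by \<open>asym_mult_class\<close> below this is a single class.\<close>

definition asymptotic_limit ::
  "(nat \<Rightarrow> 'g monoid) \<Rightarrow> (nat \<Rightarrow> nat \<Rightarrow> 'g \<Rightarrow> 'g) \<Rightarrow> ((nat \<Rightarrow> nat) \<times> (nat \<Rightarrow> 'g)) set monoid" where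
  "asymptotic_limit G p =
     \<lparr>carrier = asym_seqs G // asym_rel G p,
      monoid.mult = (\<lambda>A B. \<Union>a\<in>A. \<Union>b\<in>B. asym_rel G p `` {asym_mult G p a b}),
      one = asym_rel G p `` {(\<lambda>n. n, \<lambda>n. \<one>\<^bsub>G n\<^esub>)}\<rparr>"

lemma inverse_systemD:
  assumes "inverse_system G p"
  shows "group (G n)"
    and "n \<le> m \<Longrightarrow> p m n \<in> hom (G m) (G n)"
    and "x \<in> carrier (G n) \<Longrightarrow> p n n x = x"
    and "n \<le> m \<Longrightarrow> m \<le> l \<Longrightarrow> x \<in> carrier (G l) \<Longrightarrow> p m n (p l m x) = p l n x"
  using assms unfolding inverse_system_def by blast+

lemma inverse_system_closed:
  assumes "inverse_system G p" "n \<le> m" "x \<in> carrier (G m)"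
  shows "p m n x \<in> carrier (G n)"
  using inverse_systemD(2)[OF assms(1,2)] assms(3) by (auto simp: hom_def)

lemma filterlim_min_nat:
  fixes k l :: "nat \<Rightarrow> nat"
  assumes "filterlim k at_top sequentially" "filterlim l at_top sequentially"
  shows "filterlim (\<lambda>n. min (k n) (l n)) at_top sequentially"
  using assms unfolding filterlim_at_top by (simp add: eventually_conj)

lemma equiv_asym_rel:
  assumes I: "inverse_system G p"
  shows "equiv (asym_seqs G) (asym_rel G p)"
proof (rule equivI)
  show "asym_rel G p \<subseteq> asym_seqs G \<times> asym_seqs G"
    by (auto simp: asym_rel_def)
  show "refl_on (asym_seqs G) (asym_rel G p)"
    by (auto simp: refl_on_def asym_rel_def asym_seqs_def)
  show "sym (asym_rel G p)"
    by (auto simp: sym_def asym_rel_def asym_seqs_def eq_commute min.commute)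
  show "trans (asym_rel G p)"
  proof (rule transI, clarify)
    fix k g l h j f
    assume gh: "((k, g), (l, h)) \<in> asym_rel G p" and hf: "((l, h), (j, f)) \<in> asym_rel G p"
    from gh obtain a where a: "filterlim a at_top sequentially" "\<And>n. a n \<le> min (k n) (l n)"
      "\<forall>\<^sub>F n in sequentially. p (k n) (a n) (g n) = p (l n) (a n) (h n)"
      unfolding asym_rel_def by blast
    from hf obtain b where b: "filterlim b at_top sequentially" "\<And>n. b n \<le> min (l n) (j n)"
      "\<forall>\<^sub>F n in sequentially. p (l n) (b n) (h n) = p (j n) (b n) (f n)"
      unfolding asym_rel_def by blast
    have car: "g n \<in> carrier (G (k n))" "h n \<in> carrier (G (l n))" "f n \<in> carrier (G (j n))" for n
      using gh hf by (auto simp: asym_rel_def asym_seqs_def)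
    define m where "m n = min (a n) (b n)" for n
    have "filterlim m at_top sequentially"
      using filterlim_min_nat[OF a(1) b(1)] by (simp add: m_def[abs_def])
    moreover have "m n \<le> min (k n) (j n)" for n
      using a(2)[of n] b(2)[of n] by (auto simp: m_def)
    moreover have "\<forall>\<^sub>F n in sequentially. p (k n) (m n) (g n) = p (j n) (m n) (f n)"
      using a(3) b(3)
    proof eventually_elim
      case (elim n)
      have ma: "m n \<le> a n" "m n \<le> b n" by (auto simp: m_def)
      have le: "a n \<le> k n" "a n \<le> l n" "b n \<le> l n" "b n \<le> j n" using a(2)[of n] b(2)[of n] by auto
      note c = inverse_systemD(4)[OF I]
      have "p (k n) (m n) (g n) = p (a n) (m n) (p (k n) (a n) (g n))"
        using c[OF ma(1) le(1) car(1)] by simp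
      also have "\<dots> = p (l n) (m n) (h n)"
        using c[OF ma(1) le(2) car(2)] elim(1) by simp
      also have "\<dots> = p (b n) (m n) (p (l n) (b n) (h n))"
        using c[OF ma(2) le(3) car(2)] by simp
      also have "\<dots> = p (j n) (m n) (f n)"
        using c[OF ma(2) le(4) car(3)] elim(2) by simp
      finally show ?case .
    qed
    ultimately show "((k, g), (j, f)) \<in> asym_rel G p"
      using gh hf unfolding asym_rel_def by blast
  qed
qed

lemma asym_mult_closed:
  assumes I: "inverse_system G p" and "a \<in> asym_seqs G" "b \<in> asym_seqs G"
  shows "asym_mult G p a b \<in> asym_seqs G"
proof -
  obtain k g l h where ab: "a = (k, g)" "b = (l, h)" by (metis surj_pair)
  have "p (k n) (min (k n) (l n)) (g n) \<otimes>\<^bsub>G (min (k n) (l n))\<^esub> p (l n) (min (k n) (l n)) (h n)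
          \<in> carrier (G (min (k n) (l n)))" for n
    using assms inverse_systemD(1)[OF I]
    by (intro monoid.m_closed group.is_monoid inverse_system_closed[OF I])
       (auto simp: ab asym_seqs_def)
  then show ?thesis
    using assms by (auto simp: ab asym_seqs_def Let_def intro: filterlim_min_nat)
qed

text \<open>Multiplication of sequences respects the relation, so it descends to classes.\<close>

lemma asym_mult_respects:
  assumes I: "inverse_system G p"
    and aa: "(a, a') \<in> asym_rel G p" and bb: "(b, b') \<in> asym_rel G p"
  shows "(asym_mult G p a b, asym_mult G p a' b') \<in> asym_rel G p"
proof -
  obtain k g k' g' l h l' h' where e: "a = (k, g)" "a' = (k', g')" "b = (l, h)" "b' = (l', h')"
    by (metis surj_pair)
  have in_seqs: "a \<in> asym_seqs G" "a' \<in> asym_seqs G" "b \<in> asym_seqs G" "b' \<in> asym_seqs G"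
    using aa bb by (auto simp: asym_rel_def)
  from aa obtain u where u: "filterlim u at_top sequentially" "\<And>n. u n \<le> min (k n) (k' n)"
      "\<forall>\<^sub>F n in sequentially. p (k n) (u n) (g n) = p (k' n) (u n) (g' n)"
    unfolding asym_rel_def e by blast
  from bb obtain v where v: "filterlim v at_top sequentially" "\<And>n. v n \<le> min (l n) (l' n)"
      "\<forall>\<^sub>F n in sequentially. p (l n) (v n) (h n) = p (l' n) (v n) (h' n)"
    unfolding asym_rel_def e by blast
  have car: "g n \<in> carrier (G (k n))" "h n \<in> carrier (G (l n))"
    "g' n \<in> carrier (G (k' n))" "h' n \<in> carrier (G (l' n))" for n
    using in_seqs by (auto simp: asym_seqs_def e)
  define m where "m n = min (u n) (v n)" for n
  have "filterlim m at_top sequentially"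
    using filterlim_min_nat[OF u(1) v(1)] by (simp add: m_def[abs_def])
  moreover have mle: "m n \<le> min (min (k n) (l n)) (min (k' n) (l' n))" for n
    using u(2)[of n] v(2)[of n] by (auto simp: m_def)
  moreover
  have push: "p M s (p i M x \<otimes>\<^bsub>G M\<^esub> p j M y) = p i s x \<otimes>\<^bsub>G s\<^esub> p j s y"
    if "s \<le> M" "M \<le> i" "M \<le> j" "x \<in> carrier (G i)" "y \<in> carrier (G j)" for M s i j x y
    using inverse_systemD(2)[OF I that(1)] inverse_system_closed[OF I that(2) that(4)]
      inverse_system_closed[OF I that(3) that(5)] inverse_systemD(4)[OF I that(1) that(2) that(4)]
      inverse_systemD(4)[OF I that(1) that(3) that(5)]
    by (simp add: hom_def)
  have "\<forall>\<^sub>F n in sequentially.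
      p (min (k n) (l n)) (m n) (p (k n) (min (k n) (l n)) (g n)
        \<otimes>\<^bsub>G (min (k n) (l n))\<^esub> p (l n) (min (k n) (l n)) (h n)) =
      p (min (k' n) (l' n)) (m n) (p (k' n) (min (k' n) (l' n)) (g' n)
        \<otimes>\<^bsub>G (min (k' n) (l' n))\<^esub> p (l' n) (min (k' n) (l' n)) (h' n))"
    using u(3) v(3)
  proof eventually_elim
    case (elim n)
    have uv: "m n \<le> u n" "m n \<le> v n" by (auto simp: m_def)
    have le: "u n \<le> k n" "u n \<le> k' n" "v n \<le> l n" "v n \<le> l' n"
      using u(2)[of n] v(2)[of n] by auto
    have "p (k n) (m n) (g n) = p (k' n) (m n) (g' n)"
      using inverse_systemD(4)[OF I uv(1) le(1) car(1)] inverse_systemD(4)[OF I uv(1) le(2) car(3)]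
        elim(1) by simp
    moreover have "p (l n) (m n) (h n) = p (l' n) (m n) (h' n)"
      using inverse_systemD(4)[OF I uv(2) le(3) car(2)] inverse_systemD(4)[OF I uv(2) le(4) car(4)]
        elim(2) by simp
    ultimately show ?case
      using mle[of n] by (simp add: push car)
  qed
  ultimately have "\<exists>m. filterlim m at_top sequentially \<and>
      (\<forall>n. m n \<le> min (min (k n) (l n)) (min (k' n) (l' n))) \<and>
      (\<forall>\<^sub>F n in sequentially.
        p (min (k n) (l n)) (m n) (p (k n) (min (k n) (l n)) (g n)
          \<otimes>\<^bsub>G (min (k n) (l n))\<^esub> p (l n) (min (k n) (l n)) (h n)) =
        p (min (k' n) (l' n)) (m n) (p (k' n) (min (k' n) (l' n)) (g' n)
          \<otimes>\<^bsub>G (min (k' n) (l' n))\<^esub> p (l' n) (min (k' n) (l' n)) (h' n)))"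
    by blast
  then show ?thesis
    using asym_mult_closed[OF I in_seqs(1,3)] asym_mult_closed[OF I in_seqs(2,4)]
    unfolding asym_rel_def e asym_mult.simps Let_def mem_Collect_eq case_prod_conv by blast
qed

lemma asym_mult_class:
  assumes I: "inverse_system G p" and "a \<in> asym_seqs G" "b \<in> asym_seqs G"
  shows "(asym_rel G p `` {a}) \<otimes>\<^bsub>asymptotic_limit G p\<^esub> (asym_rel G p `` {b}) =
         asym_rel G p `` {asym_mult G p a b}"
proof -
  note E = equiv_asym_rel[OF I]
  have "asym_rel G p `` {asym_mult G p x y} = asym_rel G p `` {asym_mult G p a b}"
    if "x \<in> asym_rel G p `` {a}" "y \<in> asym_rel G p `` {b}" for x y
    using equiv_class_eq[OF E asym_mult_respects[OF I, of a x b y]] that by auto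
  moreover have "a \<in> asym_rel G p `` {a}" "b \<in> asym_rel G p `` {b}"
    using assms equiv_class_self[OF E] by auto
  ultimately show ?thesis
    unfolding asymptotic_limit_def monoid.simps by blast
qed


section \<open>Algebraic proper homology\<close>

definition alg_proper_homology ::
  "nat \<Rightarrow> 'a topology \<Rightarrow> (nat \<Rightarrow> 'a set) \<Rightarrow> ((nat \<Rightarrow> nat) \<times> (nat \<Rightarrow> 'a chain set)) set monoid" where
  "alg_proper_homology k X e =
     asymptotic_limit
       (\<lambda>n. homology_group (int k) (subtopology X (e n)))
       (\<lambda>m n. hom_induced (int k) (subtopology X (e m)) {} (subtopology X (e n)) {} id)"

lemma inverse_system_homology:
  assumes "space_end X K e"
  shows "inverse_system
       (\<lambda>n. homology_group (int k) (subtopology X (e n)))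
       (\<lambda>m n. hom_induced (int k) (subtopology X (e m)) {} (subtopology X (e n)) {} id)"
proof -
  have mono: "e m \<subseteq> e n" if "n \<le> m" for m n
    using that by (rule lift_Suc_antimono_le[rotated]) (use assms in \<open>auto simp: space_end_def\<close>)
  have cont: "continuous_map (subtopology X (e m)) (subtopology X (e n)) id" if "n \<le> m" for m n
    using mono[OF that] by (auto simp: continuous_map_in_subtopology)
  show ?thesis
    unfolding inverse_system_def
  proof (intro conjI allI impI ballI)
    fix l m n :: nat and x
    assume nm: "n \<le> m" and ml: "m \<le> l"
    from hom_induced_compose'[OF cont[OF ml] _ cont[OF nm], of "{}" "{}" "{}" "int k" x]
    show "hom_induced (int k) (subtopology X (e m)) {} (subtopology X (e n)) {} id
            (hom_induced (int k) (subtopology X (e l)) {} (subtopology X (e m)) {} id x) =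
          hom_induced (int k) (subtopology X (e l)) {} (subtopology X (e n)) {} id x"
      by simp
  qed (auto simp: hom_induced_hom hom_induced_id)
qed


section \<open>Geometric proper homology\<close>

definition chain_supp :: "nat \<Rightarrow> 'a chain \<Rightarrow> 'a set" where
  "chain_supp k c = (\<Union>f \<in> Poly_Mapping.keys c. f ` standard_simplex k)"

definition proper_chains :: "nat \<Rightarrow> 'a topology \<Rightarrow> (nat \<Rightarrow> 'a set) \<Rightarrow> (nat \<Rightarrow> 'a chain) set" where
  "proper_chains k X e =
     {c. (\<forall>n. singular_chain k X (c n)) \<and> converges_to_end (\<lambda>n. chain_supp k (c n)) e}"

definition proper_cycles :: "nat \<Rightarrow> 'a topology \<Rightarrow> (nat \<Rightarrow> 'a set) \<Rightarrow> (nat \<Rightarrow> 'a chain) set" where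
  "proper_cycles k X e =
     {c \<in> proper_chains k X e. \<forall>\<^sub>F n in sequentially. chain_boundary k (c n) = 0}"

definition proper_boundaries :: "nat \<Rightarrow> 'a topology \<Rightarrow> (nat \<Rightarrow> 'a set) \<Rightarrow> (nat \<Rightarrow> 'a chain) set" where
  "proper_boundaries k X e =
     {c \<in> proper_chains k X e. \<exists>b \<in> proper_chains (Suc k) X e.
        \<forall>\<^sub>F n in sequentially. c n = chain_boundary (Suc k) (b n)}"

definition proper_chain_group ::
  "nat \<Rightarrow> 'a topology \<Rightarrow> (nat \<Rightarrow> 'a set) \<Rightarrow> (nat \<Rightarrow> 'a chain) monoid" where
  "proper_chain_group k X e =
     (product_group UNIV (\<lambda>n. chain_group k X))\<lparr>carrier := proper_chains k X e\<rparr>"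

definition geo_proper_homology ::
  "nat \<Rightarrow> 'a topology \<Rightarrow> (nat \<Rightarrow> 'a set) \<Rightarrow> (nat \<Rightarrow> 'a chain) set monoid" where
  "geo_proper_homology k X e =
     (proper_chain_group k X e)\<lparr>carrier := proper_cycles k X e\<rparr> Mod proper_boundaries k X e"

lemma chain_supp_0 [simp]: "chain_supp k 0 = {}"
  by (simp add: chain_supp_def)

lemma chain_supp_minus [simp]: "chain_supp k (- c) = chain_supp k c"
  by (simp add: chain_supp_def)

lemma chain_supp_add: "chain_supp k (c + d) \<subseteq> chain_supp k c \<union> chain_supp k d"
  using keys_add[of c d] by (auto simp: chain_supp_def)

lemma converges_to_end_Un:
  assumes "converges_to_end Y e" "converges_to_end Z e"
  shows "converges_to_end (\<lambda>n. Y n \<union> Z n) e"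
  using assms unfolding converges_to_end_def by (metis le_trans nat_le_linear sup.bounded_iff)

lemma converges_to_end_mono:
  assumes "converges_to_end Y e" "\<And>n. Z n \<subseteq> Y n"
  shows "converges_to_end Z e"
  using assms unfolding converges_to_end_def by (meson order_trans)

lemma proper_chains_0: "(\<lambda>n. 0) \<in> proper_chains k X e"
  by (simp add: proper_chains_def converges_to_end_def)

lemma proper_chains_add:
  assumes "c \<in> proper_chains k X e" "d \<in> proper_chains k X e"
  shows "(\<lambda>n. c n + d n) \<in> proper_chains k X e"
proof -
  have "converges_to_end (\<lambda>n. chain_supp k (c n) \<union> chain_supp k (d n)) e"
    using assms by (simp add: proper_chains_def converges_to_end_Un)
  then have "converges_to_end (\<lambda>n. chain_supp k (c n + d n)) e"
    by (rule converges_to_end_mono) (rule chain_supp_add)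
  then show ?thesis
    using assms by (simp add: proper_chains_def singular_chain_add)
qed

lemma proper_chains_minus:
  assumes "c \<in> proper_chains k X e"
  shows "(\<lambda>n. - c n) \<in> proper_chains k X e"
  using assms by (simp add: proper_chains_def singular_chain_minus)

lemma mult_proper_chain_group [simp]:
  "(\<otimes>\<^bsub>proper_chain_group k X e\<^esub>) = (\<lambda>c d n. c n + d n)"
  by (simp add: proper_chain_group_def restrict_def)

lemma one_proper_chain_group [simp]: "\<one>\<^bsub>proper_chain_group k X e\<^esub> = (\<lambda>n. 0)"
  by (simp add: proper_chain_group_def restrict_def)

lemma carrier_proper_chain_group [simp]: "carrier (proper_chain_group k X e) = proper_chains k X e"
  by (simp add: proper_chain_group_def)

lemma comm_group_proper_chain_group: "comm_group (proper_chain_group k X e)"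
proof (rule comm_groupI)
  fix c assume "c \<in> carrier (proper_chain_group k X e)"
  then show "\<exists>d \<in> carrier (proper_chain_group k X e).
      d \<otimes>\<^bsub>proper_chain_group k X e\<^esub> c = \<one>\<^bsub>proper_chain_group k X e\<^esub>"
    by (intro bexI[of _ "\<lambda>n. - c n"]) (auto intro: proper_chains_minus)
qed (auto simp: add_ac proper_chains_0 proper_chains_add)

lemma inv_proper_chain_group:
  assumes "c \<in> proper_chains k X e"
  shows "inv\<^bsub>proper_chain_group k X e\<^esub> c = (\<lambda>n. - c n)"
  using assms comm_group.axioms(2)[OF comm_group_proper_chain_group]
  by (intro group.inv_equality) (auto intro: proper_chains_minus)

lemma subgroup_proper_cycles: "subgroup (proper_cycles k X e) (proper_chain_group k X e)"
proof (rule group.subgroupI)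
  show "group (proper_chain_group k X e)"
    using comm_group.axioms(2)[OF comm_group_proper_chain_group] .
  have "(\<lambda>n. 0) \<in> proper_cycles k X e"
    by (simp add: proper_cycles_def proper_chains_0)
  then show "proper_cycles k X e \<noteq> {}" by blast
  fix c d assume c: "c \<in> proper_cycles k X e"
  then show "inv\<^bsub>proper_chain_group k X e\<^esub> c \<in> proper_cycles k X e"
    by (auto simp: proper_cycles_def inv_proper_chain_group proper_chains_minus chain_boundary_minus)
  assume d: "d \<in> proper_cycles k X e"
  have "\<forall>\<^sub>F n in sequentially. chain_boundary k (c n + d n) = 0"
    using c d unfolding proper_cycles_def
    by (auto simp: chain_boundary_add elim: eventually_elim2)
  then show "c \<otimes>\<^bsub>proper_chain_group k X e\<^esub> d \<in> proper_cycles k X e"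
    using c d by (auto simp: proper_cycles_def proper_chains_add)
qed (auto simp: proper_cycles_def)

lemma proper_boundaries_subset_cycles: "proper_boundaries k X e \<subseteq> proper_cycles k X e"
proof
  fix c assume "c \<in> proper_boundaries k X e"
  then obtain b where c: "c \<in> proper_chains k X e" and b: "b \<in> proper_chains (Suc k) X e"
    and eq: "\<forall>\<^sub>F n in sequentially. c n = chain_boundary (Suc k) (b n)"
    by (auto simp: proper_boundaries_def)
  from eq have "\<forall>\<^sub>F n in sequentially. chain_boundary k (c n) = 0"
  proof eventually_elim
    case (elim n)
    have "singular_chain (Suc k) X (b n)" using b by (simp add: proper_chains_def)
    then show ?case using elim chain_boundary_boundary[of "Suc k" X "b n"] by simp
  qed
  with c show "c \<in> proper_cycles k X e" by (simp add: proper_cycles_def)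
qed

lemma subgroup_proper_boundaries: "subgroup (proper_boundaries k X e) (proper_chain_group k X e)"
proof (rule group.subgroupI)
  show "group (proper_chain_group k X e)"
    using comm_group.axioms(2)[OF comm_group_proper_chain_group] .
  have "(\<lambda>n. 0) \<in> proper_boundaries k X e"
    unfolding proper_boundaries_def using proper_chains_0
    by (auto intro!: bexI[of _ "\<lambda>n. 0"])
  then show "proper_boundaries k X e \<noteq> {}" by blast
  fix c d assume "c \<in> proper_boundaries k X e"
  then obtain a where c: "c \<in> proper_chains k X e" and a: "a \<in> proper_chains (Suc k) X e"
    and ca: "\<forall>\<^sub>F n in sequentially. c n = chain_boundary (Suc k) (a n)"
    by (auto simp: proper_boundaries_def)
  have "\<forall>\<^sub>F n in sequentially. - c n = chain_boundary (Suc k) (- a n)"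
    using ca by eventually_elim (simp add: chain_boundary_minus)
  then show "inv\<^bsub>proper_chain_group k X e\<^esub> c \<in> proper_boundaries k X e"
    unfolding inv_proper_chain_group[OF c] proper_boundaries_def
    using proper_chains_minus[OF c] by (auto intro!: bexI[OF _ proper_chains_minus[OF a]])
  assume "d \<in> proper_boundaries k X e"
  then obtain b where d: "d \<in> proper_chains k X e" and b: "b \<in> proper_chains (Suc k) X e"
    and db: "\<forall>\<^sub>F n in sequentially. d n = chain_boundary (Suc k) (b n)"
    by (auto simp: proper_boundaries_def)
  have "\<forall>\<^sub>F n in sequentially. c n + d n = chain_boundary (Suc k) (a n + b n)"
    using ca db by eventually_elim (simp add: chain_boundary_add)
  then show "c \<otimes>\<^bsub>proper_chain_group k X e\<^esub> d \<in> proper_boundaries k X e"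
    unfolding mult_proper_chain_group proper_boundaries_def
    using proper_chains_add[OF c d] by (auto intro!: bexI[OF _ proper_chains_add[OF a b]])
qed (auto simp: proper_boundaries_def)

text \<open>Hence the quotient defining \<open>geo_proper_homology\<close> is a quotient of a group by a normal
  subgroup.\<close>

lemma normal_proper_boundaries:
  "proper_boundaries k X e \<lhd> (proper_chain_group k X e)\<lparr>carrier := proper_cycles k X e\<rparr>"
proof -
  let ?C = "proper_chain_group k X e"
  have "comm_group (?C\<lparr>carrier := proper_cycles k X e\<rparr>)"
    using group.subgroup_imp_group[OF comm_group.axioms(2)[OF comm_group_proper_chain_group]
        subgroup_proper_cycles]
    by (rule group.group_comm_groupI) (simp add: add.commute)
  moreover have "subgroup (proper_boundaries k X e) (?C\<lparr>carrier := proper_cycles k X e\<rparr>)"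
    using group.subgroup_incl[OF comm_group.axioms(2)[OF comm_group_proper_chain_group]
        subgroup_proper_boundaries subgroup_proper_cycles proper_boundaries_subset_cycles] .
  ultimately show ?thesis
    by (simp add: comm_group.normal_iff_subgroup)
qed

end

theory Submission
  imports Defs
begin

text \<open>
  A proper cycle \<open>c\<close> and an asymptotic sequence \<open>(l, g)\<close> of homology classes carry the same data as
  soon as, for large \<open>n\<close>, the chain \<open>c n\<close> is a cycle inside \<open>e (l n)\<close> whose class there is \<open>g n\<close>;
  then \<open>c\<close> represents \<open>(l, g)\<close>. Convergence of the supports to the end is exactly what lets
  one choose indices \<open>l n\<close> tending to infinity with \<open>c n\<close> inside \<open>e (l n)\<close>, so every proper cycle
  represents something (\<open>proper_cycle_represents\<close>); choosing cycles in the given classes shows that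
  every sequence is represented (\<open>asym_seq_represented\<close>).

  The two equivalence relations correspond as well (\<open>asym_rel_iff_proper_boundary\<close>). The sequences
  represented by \<open>c\<close> and \<open>d\<close> are identified if \<open>c n\<close> and \<open>d n\<close> become homologous in some
  \<open>e (m n)\<close> with \<open>m n\<close> tending to infinity, and the chains realising these homologies form a sequence
  that converges to the end because their supports lie in \<open>e (m n)\<close>. Conversely, a proper chain
  bounding \<open>c - d\<close> lies in \<open>e (m n)\<close> for some such \<open>m\<close>, which may be lowered at will.

  So sending a cycle to the class of what it represents is a well-defined surjection onto the
  asymptotic limit with kernel the proper boundaries. It is additive because classes add at any common
  level, and the first isomorphism theorem applies.
\<close>

section \<open>Rates of convergence to infinity\<close>

text \<open>A diagonal argument: at stage \<open>n\<close> take the largest index up to \<open>n\<close> for which the property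
  already holds.\<close>

lemma eventually_all_imp_divergent_index:
  assumes "\<And>i. \<forall>\<^sub>F n in sequentially. P n i"
  shows "\<exists>m :: nat \<Rightarrow> nat. filterlim m at_top sequentially \<and> (\<forall>\<^sub>F n in sequentially. P n (m n))"
proof -
  \<comment> \<open>The index \<open>0\<close> is a default for the finitely many \<open>n\<close> where no index up to \<open>n\<close> qualifies.\<close>
  define S where "S n = insert 0 {i. i \<le> n \<and> P n i}" for n
  define m where "m n = Max (S n)" for n
  have fin: "finite (S n)" "S n \<noteq> {}" for n
    by (auto simp: S_def)
  have "\<forall>\<^sub>F n in sequentially. i \<le> m n" for i
    using assms[of i] eventually_ge_at_top[of i]
  proof eventually_elim
    case (elim n)
    then have "i \<in> S n" by (simp add: S_def)
    then show ?case unfolding m_def using fin by simp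
  qed
  then have "filterlim m at_top sequentially"
    by (simp add: filterlim_at_top)
  moreover have "\<forall>\<^sub>F n in sequentially. P n (m n)"
    using assms[of 0]
  proof eventually_elim
    case (elim n)
    have "m n \<in> S n"
      unfolding m_def using fin by (intro Max_in)
    with elim show ?case by (auto simp: S_def)
  qed
  ultimately show ?thesis by blast
qed

lemma converges_to_end_imp_divergent_index:
  assumes "converges_to_end Z e"
  obtains m where "filterlim m at_top sequentially" "\<forall>\<^sub>F n in sequentially. Z n \<subseteq> e (m n)"
  using eventually_all_imp_divergent_index[of "\<lambda>n i. Z n \<subseteq> e i"] assms
  by (auto simp: converges_to_end_def eventually_sequentially)

lemma space_end_antimono:
  assumes "space_end X K e" "n \<le> m"
  shows "e m \<subseteq> e n"
  using assms by (intro lift_Suc_antimono_le[of e, OF _ assms(2)]) (auto simp: space_end_def)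

lemma converges_to_endI:
  assumes "space_end X K e" "filterlim m at_top sequentially"
    and "\<forall>\<^sub>F n in sequentially. Z n \<subseteq> e (m n)"
  shows "converges_to_end Z e"
proof -
  have "\<forall>\<^sub>F n in sequentially. Z n \<subseteq> e i" for i
    using assms(3) filterlim_at_top[THEN iffD1, OF assms(2), rule_format, of i]
    by eventually_elim (use space_end_antimono[OF assms(1)] in blast)
  then show ?thesis
    by (simp add: converges_to_end_def eventually_sequentially)
qed


section \<open>Chains and classes in the neighbourhoods of an end\<close>

lemma singular_chain_subtopology_supp:
  "singular_chain p (subtopology X S) c \<longleftrightarrow> singular_chain p X c \<and> chain_supp p c \<subseteq> S"
  by (auto simp: singular_chain_subtopology chain_supp_def)

lemma singular_cycle_subtopology:
  "singular_relcycle p (subtopology X S) {} c \<longleftrightarrow>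
     singular_chain p X c \<and> chain_supp p c \<subseteq> S \<and> chain_boundary p c = 0"
  by (simp add: singular_cycle singular_chain_subtopology_supp)

text \<open>Inclusions act on homology classes by regarding a cycle as a cycle in the larger space.\<close>

lemma hom_induced_inclusion:
  assumes "S \<subseteq> T" "singular_relcycle p (subtopology X S) {} c"
  shows "hom_induced (int p) (subtopology X S) {} (subtopology X T) {} id
           (homologous_rel_set p (subtopology X S) {} c) =
         homologous_rel_set p (subtopology X T) {} c"
proof -
  have "continuous_map (subtopology X S) (subtopology X T) id"
    using assms(1) by (auto simp: continuous_map_in_subtopology)
  moreover have "chain_map p id c = c"
    using assms(2) by (intro chain_map_ident) (auto simp: singular_relcycle_def)
  ultimately show ?thesis
    using hom_induced_chain_map[OF _ _ assms(2), of "subtopology X T" id "{}"] by simp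
qed

lemma homologous_classes_mult:
  "homologous_rel_set p X S c \<otimes>\<^bsub>relative_homology_group (int p) X S\<^esub> homologous_rel_set p X S d =
   homologous_rel_set p X S (c + d)"
proof -
  have "\<exists>r. homologous_rel p X S c r \<and> (\<exists>s. homologous_rel p X S d s \<and> x = r + s)"
    if "homologous_rel p X S (c + d) x" for x
  proof (intro exI conjI)
    show "homologous_rel p X S d (x - c)"
      using homologous_rel_diff[OF that homologous_rel_refl[of p X S c]] by simp
  qed simp_all
  then show ?thesis
    unfolding mult_relative_homology_group using homologous_rel_add[of p X S c _ d] by auto
qed

lemma homologous_class_eq_iff_boundary:
  "homologous_rel_set p (subtopology X S) {} c = homologous_rel_set p (subtopology X S) {} d \<longleftrightarrow>
     (\<exists>b. singular_chain (Suc p) X b \<and> chain_supp (Suc p) b \<subseteq> S \<and>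
          c - d = chain_boundary (Suc p) b)"
  unfolding homologous_rel_set_eq
  unfolding homologous_rel_def singular_boundary singular_chain_subtopology_supp
  by (metis (no_types))


section \<open>Representing asymptotic sequences by proper cycles\<close>

abbreviation end_homology :: "nat \<Rightarrow> 'a topology \<Rightarrow> (nat \<Rightarrow> 'a set) \<Rightarrow> nat \<Rightarrow> 'a chain set monoid" where
  "end_homology k X e \<equiv> \<lambda>n. homology_group (int k) (subtopology X (e n))"

abbreviation end_bonding ::
  "nat \<Rightarrow> 'a topology \<Rightarrow> (nat \<Rightarrow> 'a set) \<Rightarrow> nat \<Rightarrow> nat \<Rightarrow> 'a chain set \<Rightarrow> 'a chain set" where
  "end_bonding k X e \<equiv>
     \<lambda>m n. hom_induced (int k) (subtopology X (e m)) {} (subtopology X (e n)) {} id"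

text \<open>The condition is only imposed for large \<open>n\<close>, because finitely many terms of a proper cycle may
  fail to be cycles or may leave \<open>e 0\<close>.\<close>

definition represents ::
  "nat \<Rightarrow> 'a topology \<Rightarrow> (nat \<Rightarrow> 'a set) \<Rightarrow> (nat \<Rightarrow> 'a chain) \<Rightarrow> (nat \<Rightarrow> nat) \<times> (nat \<Rightarrow> 'a chain set)
     \<Rightarrow> bool" where
  "represents k X e c a \<longleftrightarrow> a \<in> asym_seqs (end_homology k X e) \<and>
     (\<forall>\<^sub>F n in sequentially.
        singular_relcycle k (subtopology X (e (fst a n))) {} (c n) \<and>
        snd a n = homologous_rel_set k (subtopology X (e (fst a n))) {} (c n))"

lemma proper_cycle_represents:
  assumes c: "c \<in> proper_cycles k X e"
  shows "\<exists>a. represents k X e c a"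
proof -
  have ch: "singular_chain k X (c n)" for n
    using c by (simp add: proper_cycles_def proper_chains_def)
  have "converges_to_end (\<lambda>n. chain_supp k (c n)) e"
    using c by (simp add: proper_cycles_def proper_chains_def)
  then obtain l where l: "filterlim l at_top sequentially"
      "\<forall>\<^sub>F n in sequentially. chain_supp k (c n) \<subseteq> e (l n)"
    by (rule converges_to_end_imp_divergent_index)
  let ?cyc = "\<lambda>n. singular_relcycle k (subtopology X (e (l n))) {} (c n)"
  \<comment> \<open>Where \<open>c n\<close> is not a cycle in \<open>e (l n)\<close>, the zero cycle stands in to give some class.\<close>
  define g where
    "g n = homologous_rel_set k (subtopology X (e (l n))) {} (if ?cyc n then c n else 0)" for n
  have "g n \<in> carrier (end_homology k X e (l n))" for n
    unfolding g_def carrier_relative_homology_group by (intro imageI) auto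
  then have "(l, g) \<in> asym_seqs (end_homology k X e)"
    using l(1) by (simp add: asym_seqs_def)
  moreover have "\<forall>\<^sub>F n in sequentially. chain_boundary k (c n) = 0"
    using c by (simp add: proper_cycles_def)
  then have "\<forall>\<^sub>F n in sequentially. ?cyc n"
    using l(2) by eventually_elim (simp add: singular_cycle_subtopology ch)
  then have "\<forall>\<^sub>F n in sequentially.
      ?cyc n \<and> g n = homologous_rel_set k (subtopology X (e (l n))) {} (c n)"
    by eventually_elim (simp add: g_def)
  ultimately have "represents k X e c (l, g)"
    by (simp add: represents_def)
  then show ?thesis ..
qed

lemma asym_seq_represented:
  assumes E: "space_end X K e" and a: "a \<in> asym_seqs (end_homology k X e)"
  shows "\<exists>c \<in> proper_cycles k X e. represents k X e c a"
proof -
  obtain l g where lg: "a = (l, g)" by fastforce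
  have l: "filterlim l at_top sequentially"
    using a by (simp add: lg asym_seqs_def)
  have "\<exists>z. singular_relcycle k (subtopology X (e (l n))) {} z \<and>
            g n = homologous_rel_set k (subtopology X (e (l n))) {} z" for n
    using a by (auto simp: lg asym_seqs_def carrier_relative_homology_group)
  then obtain c where c: "\<And>n. singular_relcycle k (subtopology X (e (l n))) {} (c n)"
      "\<And>n. g n = homologous_rel_set k (subtopology X (e (l n))) {} (c n)"
    by metis
  have "converges_to_end (\<lambda>n. chain_supp k (c n)) e"
    using c(1) by (intro converges_to_endI[OF E l]) (simp add: singular_cycle_subtopology)
  then have "c \<in> proper_cycles k X e"
    using c(1) by (simp add: proper_cycles_def proper_chains_def singular_cycle_subtopology)
  moreover have "represents k X e c a"
    using a c by (simp add: represents_def lg)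
  ultimately show ?thesis by blast
qed

lemma represents_zero:
  "represents k X e (\<lambda>n. 0) (\<lambda>n. n, \<lambda>n. \<one>\<^bsub>end_homology k X e n\<^esub>)"
proof -
  have "\<one>\<^bsub>end_homology k X e n\<^esub> = homologous_rel_set k (subtopology X (e n)) {} 0" for n
    by (simp add: homologous_rel_set_eq_relboundary[THEN iffD2])
  moreover have "\<one>\<^bsub>end_homology k X e n\<^esub> \<in> carrier (end_homology k X e n)" for n
    by (intro monoid.one_closed group.is_monoid) simp
  ultimately show ?thesis
    by (simp add: represents_def asym_seqs_def filterlim_ident)
qed

text \<open>The bonding maps in the product of sequences move both classes to the common level, where they
  add because they are classes of the unchanged cycles.\<close>

lemma represents_add:
  assumes E: "space_end X K e"
    and ca: "represents k X e c a" and db: "represents k X e d b"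
  shows "represents k X e (\<lambda>n. c n + d n) (asym_mult (end_homology k X e) (end_bonding k X e) a b)"
proof -
  obtain l g where a: "a = (l, g)" by fastforce
  obtain j h where b: "b = (j, h)" by fastforce
  let ?Y = "\<lambda>i. subtopology X (e i)"
  let ?m = "\<lambda>n. min (l n) (j n)"
  have "asym_mult (end_homology k X e) (end_bonding k X e) a b \<in> asym_seqs (end_homology k X e)"
    using ca db by (intro asym_mult_closed[OF inverse_system_homology[OF E]]) (auto simp: represents_def)
  moreover have "\<forall>\<^sub>F n in sequentially. singular_relcycle k (?Y (l n)) {} (c n) \<and>
        g n = homologous_rel_set k (?Y (l n)) {} (c n)"
      "\<forall>\<^sub>F n in sequentially. singular_relcycle k (?Y (j n)) {} (d n) \<and>
        h n = homologous_rel_set k (?Y (j n)) {} (d n)"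
    using ca db by (simp_all add: represents_def a b)
  then have "\<forall>\<^sub>F n in sequentially. singular_relcycle k (?Y (?m n)) {} (c n + d n) \<and>
      end_bonding k X e (l n) (?m n) (g n)
        \<otimes>\<^bsub>end_homology k X e (?m n)\<^esub> end_bonding k X e (j n) (?m n) (h n) =
      homologous_rel_set k (?Y (?m n)) {} (c n + d n)"
  proof eventually_elim
    case (elim n)
    have sub: "e (l n) \<subseteq> e (?m n)" "e (j n) \<subseteq> e (?m n)"
      using space_end_antimono[OF E] by simp_all
    then have "singular_relcycle k (?Y (?m n)) {} (c n)" "singular_relcycle k (?Y (?m n)) {} (d n)"
      using elim by (auto simp: singular_cycle_subtopology)
    then show ?case
      using elim sub by (simp add: hom_induced_inclusion homologous_classes_mult singular_relcycle_add)
  qed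
  ultimately show ?thesis
    by (simp add: represents_def a b Let_def)
qed

text \<open>A proper boundary is a sequence of homologies whose levels tend to infinity; this is what the
  asymptotic relation asks for.\<close>

lemma asym_rel_iff_proper_boundary:
  assumes E: "space_end X K e"
    and c: "c \<in> proper_cycles k X e" and d: "d \<in> proper_cycles k X e"
    and ca: "represents k X e c a" and db: "represents k X e d b"
  shows "(a, b) \<in> asym_rel (end_homology k X e) (end_bonding k X e) \<longleftrightarrow>
         (\<lambda>n. c n - d n) \<in> proper_boundaries k X e"
proof -
  obtain l g where a: "a = (l, g)" by fastforce
  obtain j h where b: "b = (j, h)" by fastforce
  let ?Y = "\<lambda>i. subtopology X (e i)"
  have seqs: "a \<in> asym_seqs (end_homology k X e)" "b \<in> asym_seqs (end_homology k X e)"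
    using ca db by (simp_all add: represents_def)
  have ev: "\<forall>\<^sub>F n in sequentially. singular_relcycle k (?Y (l n)) {} (c n) \<and>
        g n = homologous_rel_set k (?Y (l n)) {} (c n)"
      "\<forall>\<^sub>F n in sequentially. singular_relcycle k (?Y (j n)) {} (d n) \<and>
        h n = homologous_rel_set k (?Y (j n)) {} (d n)"
    using ca db by (simp_all add: represents_def a b)
  \<comment> \<open>Identification at the levels \<open>m n\<close> means being homologous in \<open>e (m n)\<close>.\<close>
  have level: "\<forall>\<^sub>F n in sequentially.
      end_bonding k X e (l n) (m n) (g n) = end_bonding k X e (j n) (m n) (h n) \<longleftrightarrow>
      (\<exists>y. singular_chain (Suc k) X y \<and> chain_supp (Suc k) y \<subseteq> e (m n) \<and>
           c n - d n = chain_boundary (Suc k) y)"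
    if m: "\<And>n. m n \<le> min (l n) (j n)" for m
    using ev
  proof eventually_elim
    case (elim n)
    have "e (l n) \<subseteq> e (m n)" "e (j n) \<subseteq> e (m n)"
      using m[of n] space_end_antimono[OF E] by simp_all
    with elim show ?case
      by (simp add: hom_induced_inclusion homologous_class_eq_iff_boundary)
  qed
  have chain: "(\<lambda>n. c n - d n) \<in> proper_chains k X e"
    using proper_chains_add[of c k X e, OF _ proper_chains_minus[of d]] c d
    by (simp add: proper_cycles_def)
  show ?thesis
  proof
    assume "(a, b) \<in> asym_rel (end_homology k X e) (end_bonding k X e)"
    then obtain m where m: "filterlim m at_top sequentially" "\<And>n. m n \<le> min (l n) (j n)"
        "\<forall>\<^sub>F n in sequentially. end_bonding k X e (l n) (m n) (g n) = end_bonding k X e (j n) (m n) (h n)"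
      by (auto simp: asym_rel_def a b)
    let ?Q = "\<lambda>n y. singular_chain (Suc k) X y \<and> chain_supp (Suc k) y \<subseteq> e (m n) \<and>
        c n - d n = chain_boundary (Suc k) y"
    have ex: "\<forall>\<^sub>F n in sequentially. \<exists>y. ?Q n y"
      using level[OF m(2)] m(3) by eventually_elim simp
    define y where "y n = (if \<exists>y. ?Q n y then SOME y. ?Q n y else 0)" for n
    have "?Q n (y n)" if "\<exists>y. ?Q n y" for n
      unfolding y_def if_P[OF that] by (rule someI_ex[OF that])
    then have y: "\<forall>\<^sub>F n in sequentially. ?Q n (y n)"
      and all: "singular_chain (Suc k) X (y n)" for n
      using ex by (auto elim: eventually_mono simp: y_def)
    have "converges_to_end (\<lambda>n. chain_supp (Suc k) (y n)) e"
      using y by (intro converges_to_endI[OF E m(1)]) (auto elim: eventually_mono)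
    then have "y \<in> proper_chains (Suc k) X e"
      using all by (simp add: proper_chains_def)
    with y show "(\<lambda>n. c n - d n) \<in> proper_boundaries k X e"
      using chain by (auto simp: proper_boundaries_def elim: eventually_mono)
  next
    assume "(\<lambda>n. c n - d n) \<in> proper_boundaries k X e"
    then obtain y where y: "y \<in> proper_chains (Suc k) X e"
        "\<forall>\<^sub>F n in sequentially. c n - d n = chain_boundary (Suc k) (y n)"
      by (auto simp: proper_boundaries_def)
    have "converges_to_end (\<lambda>n. chain_supp (Suc k) (y n)) e"
      using y(1) by (simp add: proper_chains_def)
    then obtain i where i: "filterlim i at_top sequentially"
        "\<forall>\<^sub>F n in sequentially. chain_supp (Suc k) (y n) \<subseteq> e (i n)"
      by (rule converges_to_end_imp_divergent_index)
    define m where "m n = min (i n) (min (l n) (j n))" for n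
    have mle: "m n \<le> min (l n) (j n)" for n
      unfolding m_def by (rule min.cobounded2)
    have "filterlim m at_top sequentially"
      unfolding m_def[abs_def] using seqs i(1) a b
      by (intro filterlim_min_nat) (auto simp: asym_seqs_def)
    moreover have "\<forall>\<^sub>F n in sequentially.
        end_bonding k X e (l n) (m n) (g n) = end_bonding k X e (j n) (m n) (h n)"
      using level[OF mle] y(2) i(2)
    proof eventually_elim
      case (elim n)
      have "chain_supp (Suc k) (y n) \<subseteq> e (m n)"
        using elim(3) space_end_antimono[OF E, of "m n" "i n"] by (auto simp: m_def)
      moreover have "singular_chain (Suc k) X (y n)"
        using y(1) by (simp add: proper_chains_def)
      ultimately show ?case
        using elim by blast
    qed
    ultimately show "(a, b) \<in> asym_rel (end_homology k X e) (end_bonding k X e)"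
      using seqs mle unfolding asym_rel_def a b by blast
  qed
qed


section \<open>The isomorphism\<close>

text \<open>Taking the union over all represented sequences avoids choosing one; by
  \<open>asym_rel_iff_proper_boundary\<close> with \<open>c = d\<close>, the union is a single class.\<close>

definition represented_class ::
  "nat \<Rightarrow> 'a topology \<Rightarrow> (nat \<Rightarrow> 'a set) \<Rightarrow> (nat \<Rightarrow> 'a chain) \<Rightarrow> ((nat \<Rightarrow> nat) \<times> (nat \<Rightarrow> 'a chain set)) set"
  where
  "represented_class k X e c =
     asym_rel (end_homology k X e) (end_bonding k X e) `` {a. represents k X e c a}"

lemma represented_class_eq:
  assumes E: "space_end X K e" and c: "c \<in> proper_cycles k X e" and ca: "represents k X e c a"
  shows "represented_class k X e c = asym_rel (end_homology k X e) (end_bonding k X e) `` {a}"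
proof -
  note R = equiv_asym_rel[OF inverse_system_homology[OF E, of k]]
  have "asym_rel (end_homology k X e) (end_bonding k X e) `` {b} =
        asym_rel (end_homology k X e) (end_bonding k X e) `` {a}" if "represents k X e c b" for b
  proof (rule equiv_class_eq[OF R])
    show "(b, a) \<in> asym_rel (end_homology k X e) (end_bonding k X e)"
      unfolding asym_rel_iff_proper_boundary[OF E c c that ca]
      using subgroup.one_closed[OF subgroup_proper_boundaries[of k X e]] by simp
  qed
  then show ?thesis
    unfolding represented_class_def using ca by blast
qed

lemma represented_class_eq_iff:
  assumes E: "space_end X K e" and c: "c \<in> proper_cycles k X e" and d: "d \<in> proper_cycles k X e"
  shows "represented_class k X e c = represented_class k X e d \<longleftrightarrow>
         (\<lambda>n. c n - d n) \<in> proper_boundaries k X e"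
proof -
  obtain a b where ab: "represents k X e c a" "represents k X e d b"
    using proper_cycle_represents c d by blast
  then have "a \<in> asym_seqs (end_homology k X e)" "b \<in> asym_seqs (end_homology k X e)"
    by (simp_all add: represents_def)
  then show ?thesis
    unfolding asym_rel_iff_proper_boundary[OF E c d ab, symmetric]
      represented_class_eq[OF E c ab(1)] represented_class_eq[OF E d ab(2)]
    by (rule eq_equiv_class_iff[OF equiv_asym_rel[OF inverse_system_homology[OF E]]])
qed

lemma represented_class_hom:
  assumes E: "space_end X K e"
  shows "represented_class k X e \<in>
    hom ((proper_chain_group k X e)\<lparr>carrier := proper_cycles k X e\<rparr>) (alg_proper_homology k X e)"
proof (rule homI; simp)
  fix c assume c: "c \<in> proper_cycles k X e"
  then obtain a where a: "represents k X e c a"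
    using proper_cycle_represents by blast
  then have "a \<in> asym_seqs (end_homology k X e)"
    by (simp add: represents_def)
  then show "represented_class k X e c \<in> carrier (alg_proper_homology k X e)"
    unfolding represented_class_eq[OF E c a]
    by (simp add: alg_proper_homology_def asymptotic_limit_def quotientI)
  fix d assume d: "d \<in> proper_cycles k X e"
  then obtain b where b: "represents k X e d b"
    using proper_cycle_represents by blast
  have cd: "(\<lambda>n. c n + d n) \<in> proper_cycles k X e"
    using subgroup.m_closed[OF subgroup_proper_cycles c d] by simp
  show "represented_class k X e (\<lambda>n. c n + d n) =
        represented_class k X e c \<otimes>\<^bsub>alg_proper_homology k X e\<^esub> represented_class k X e d"
    unfolding represented_class_eq[OF E c a] represented_class_eq[OF E d b]
      represented_class_eq[OF E cd represents_add[OF E a b]] alg_proper_homology_def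
    using a b
    by (intro asym_mult_class[OF inverse_system_homology[OF E], symmetric])
       (auto simp: represents_def)
qed

lemma represented_class_surj:
  assumes E: "space_end X K e"
  shows "represented_class k X e ` proper_cycles k X e = carrier (alg_proper_homology k X e)"
proof
  show "represented_class k X e ` proper_cycles k X e \<subseteq> carrier (alg_proper_homology k X e)"
    using hom_in_carrier[OF represented_class_hom[OF E, of k]] by auto
  show "carrier (alg_proper_homology k X e) \<subseteq> represented_class k X e ` proper_cycles k X e"
  proof
    fix A assume "A \<in> carrier (alg_proper_homology k X e)"
    then obtain a where a: "a \<in> asym_seqs (end_homology k X e)"
        and A: "A = asym_rel (end_homology k X e) (end_bonding k X e) `` {a}"
      by (auto simp: alg_proper_homology_def asymptotic_limit_def elim: quotientE)
    obtain c where "c \<in> proper_cycles k X e" "represents k X e c a"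
      using asym_seq_represented[OF E a] by blast
    then show "A \<in> represented_class k X e ` proper_cycles k X e"
      using A represented_class_eq[OF E] by blast
  qed
qed

lemma represented_class_zero:
  assumes E: "space_end X K e"
  shows "represented_class k X e (\<lambda>n. 0) = \<one>\<^bsub>alg_proper_homology k X e\<^esub>"
  using represented_class_eq[OF E _ represents_zero] subgroup.one_closed[OF subgroup_proper_cycles[of k X e]]
  by (simp add: alg_proper_homology_def asymptotic_limit_def)

theorem theorem4p5:
  fixes X :: "'a topology" and K e :: "nat \<Rightarrow> 'a set" and k :: nat
  assumes "nice_space X"
    and "efficient_exhaustion X K"
    and "space_end X K e"
  shows "geo_proper_homology k X e \<cong> alg_proper_homology k X e"
proof -
  let ?Z = "(proper_chain_group k X e)\<lparr>carrier := proper_cycles k X e\<rparr>"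
  let ?A = "alg_proper_homology k X e"
  let ?h = "represented_class k X e"
  note E = assms(3)
  have Z: "group ?Z"
    using group.subgroup_imp_group[OF comm_group.axioms(2)[OF comm_group_proper_chain_group]
        subgroup_proper_cycles] .
  \<comment> \<open>The asymptotic limit is a group because it is the whole image of a homomorphism.\<close>
  have "?A = ?A\<lparr>carrier := ?h ` carrier ?Z, one := ?h \<one>\<^bsub>?Z\<^esub>\<rparr>"
    using represented_class_surj[OF E, of k] represented_class_zero[OF E, of k] by simp
  then have A: "group ?A"
    using group.hom_imp_img_group[OF Z represented_class_hom[OF E]] by simp
  have hom: "group_hom ?Z ?A ?h"
    using Z A represented_class_hom[OF E] by (simp add: group_hom_def group_hom_axioms_def)
  have "kernel ?Z ?A ?h = proper_boundaries k X e"
    using represented_class_eq_iff[OF E _ subgroup.one_closed[OF subgroup_proper_cycles[of k X e]]]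
      represented_class_zero[OF E, of k] proper_boundaries_subset_cycles[of k X e]
    by (auto simp: kernel_def)
  moreover have "?h ` carrier ?Z = carrier ?A"
    using represented_class_surj[OF E] by simp
  ultimately show ?thesis
    using group_hom.FactGroup_iso[OF hom] by (simp add: geo_proper_homology_def)
qed

end
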